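(* Let $h\ge 3$ and $n\ge 1$ be integers and let $M_n$ be a meta-chain of length $n$ all of whose cycles have $h$ vertices. Then the independence number of $M_n$ is $$\alpha(M_n)=n\cdot\left\lfloor\frac{h}{2}\right\rfloor.$$
   Context: All graphs are finite and simple. $\alpha(G)$ is the independence number of $G$, i.e. the largest number of vertices in an independent set of $G$. A cactus is a connected graph in which each edge lies in at most one cycle. A chain cactus is a cactus in which each block is a cycle containing at most two cut vertices and each cut vertex is contained in exactly two cycles; its length is the number of its cycles. A chain $h$-cactus is a chain cactus all of whose cycles have exactly $h$ vertices. In a chain cactus of length $n$ the cycles are denoted $C^{(1)},\dots,C^{(n)}$ in their order along the chain (consecutive cycles share one cut vertex). Internal cycles are $C^{(2)},\dots,C^{(n-1)}$; each contains exactly two cut vertices. An internal cycle is in $k$-position if its two cut vertices are at distance $k$ (in the cycle); $2$-position is called meta-position. The meta-chain $M_n$ is the chain $h$-cactus of length $n$ all of whose internal cycles are in meta-position (for $n\ge 3$ this exists only when $h\ge 4$); $M_1$ is the cycle $C_h$, and $M_2$ is two $h$-cycles sharing one vertex. *)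

theory Defs
  imports Main
begin

record 'a graph =
  verts :: "'a set"
  edges :: "'a set set"

definition simple_graph :: "'a graph \<Rightarrow> bool" where
  "simple_graph G \<longleftrightarrow> finite (verts G) \<and> (\<forall>e\<in>edges G. e \<subseteq> verts G \<and> card e = 2)"

definition subgraph :: "'a graph \<Rightarrow> 'a graph \<Rightarrow> bool" where
  "subgraph H G \<longleftrightarrow> simple_graph H \<and> verts H \<subseteq> verts G \<and> edges H \<subseteq> edges G"

definition adj :: "'a graph \<Rightarrow> 'a \<Rightarrow> 'a \<Rightarrow> bool" where
  "adj G u v \<longleftrightarrow> {u, v} \<in> edges G"

definition independent_set :: "'a graph \<Rightarrow> 'a set \<Rightarrow> bool" where
  "independent_set G S \<longleftrightarrow> S \<subseteq> verts G \<and> (\<forall>u\<in>S. \<forall>v\<in>S. \<not> adj G u v)"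

definition independence_number :: "'a graph \<Rightarrow> nat" where
  "independence_number G = Max (card ` {S. independent_set G S})"

definition connected_graph :: "'a graph \<Rightarrow> bool" where
  "connected_graph G \<longleftrightarrow> verts G \<noteq> {} \<and> (\<forall>u\<in>verts G. \<forall>v\<in>verts G. (adj G)\<^sup>*\<^sup>* u v)"

(* Only meaningful when u and v lie in the same component; used below only inside a cycle. *)
definition graph_dist :: "'a graph \<Rightarrow> 'a \<Rightarrow> 'a \<Rightarrow> nat" where
  "graph_dist G u v = (LEAST k. (adj G ^^ k) u v)"

definition delete_vertex :: "'a graph \<Rightarrow> 'a \<Rightarrow> 'a graph" where
  "delete_vertex G v = \<lparr>verts = verts G - {v}, edges = {e \<in> edges G. v \<notin> e}\<rparr>"

(* Deleting v increases the number of components, i.e. it splits some component;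
   in particular the vertex of a one-vertex graph is not a cut vertex. *)
definition cut_vertex :: "'a graph \<Rightarrow> 'a \<Rightarrow> bool" where
  "cut_vertex G v \<longleftrightarrow> v \<in> verts G \<and>
     (\<exists>x \<in> verts G - {v}. \<exists>y \<in> verts G - {v}.
        (adj G)\<^sup>*\<^sup>* x y \<and> \<not> (adj (delete_vertex G v))\<^sup>*\<^sup>* x y)"

definition nonseparable :: "'a graph \<Rightarrow> bool" where
  "nonseparable G \<longleftrightarrow> connected_graph G \<and> (\<forall>v. \<not> cut_vertex G v)"

definition block :: "'a graph \<Rightarrow> 'a graph \<Rightarrow> bool" where
  "block G B \<longleftrightarrow> subgraph B G \<and> nonseparable B \<and>
     (\<forall>H. subgraph H G \<and> nonseparable H \<and> subgraph B H \<longrightarrow> H = B)"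

definition cycle_of_list :: "'a list \<Rightarrow> 'a graph" where
  "cycle_of_list vs = \<lparr>verts = set vs,
     edges = {{vs ! i, vs ! (Suc i mod length vs)} | i. i < length vs}\<rparr>"

definition is_cycle :: "'a graph \<Rightarrow> bool" where
  "is_cycle C \<longleftrightarrow> (\<exists>vs. distinct vs \<and> length vs \<ge> 3 \<and> C = cycle_of_list vs)"

(* Cycles are subgraphs, so rotations and reversals of a vertex list are not counted separately. *)
definition cycles :: "'a graph \<Rightarrow> 'a graph set" where
  "cycles G = {C. subgraph C G \<and> is_cycle C}"

definition cactus :: "'a graph \<Rightarrow> bool" where
  "cactus G \<longleftrightarrow> simple_graph G \<and> connected_graph G \<and>
     (\<forall>e\<in>edges G. \<forall>C\<in>cycles G. \<forall>D\<in>cycles G. e \<in> edges C \<and> e \<in> edges D \<longrightarrow> C = D)"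

definition cut_vertices_in :: "'a graph \<Rightarrow> 'a graph \<Rightarrow> 'a set" where
  "cut_vertices_in G C = {v \<in> verts C. cut_vertex G v}"

definition chain_cactus :: "'a graph \<Rightarrow> bool" where
  "chain_cactus G \<longleftrightarrow> cactus G \<and>
     (\<forall>B. block G B \<longrightarrow> is_cycle B \<and> card (cut_vertices_in G B) \<le> 2) \<and>
     (\<forall>v. cut_vertex G v \<longrightarrow> card {C \<in> cycles G. v \<in> verts C} = 2)"

definition chain_length :: "'a graph \<Rightarrow> nat" where
  "chain_length G = card (cycles G)"

definition chain_h_cactus :: "nat \<Rightarrow> 'a graph \<Rightarrow> bool" where
  "chain_h_cactus h G \<longleftrightarrow> chain_cactus G \<and> (\<forall>C\<in>cycles G. card (verts C) = h)"

definition chain_order :: "'a graph \<Rightarrow> (nat \<Rightarrow> 'a graph) \<Rightarrow> bool" where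
  "chain_order G C \<longleftrightarrow> bij_betw C {1..chain_length G} (cycles G) \<and>
     (\<forall>i\<in>{1..<chain_length G}. \<exists>v. cut_vertex G v \<and> verts (C i) \<inter> verts (C (Suc i)) = {v})"

(* The order along the chain is unique up to reversal, which does not affect being internal. *)
definition internal_cycle :: "'a graph \<Rightarrow> 'a graph \<Rightarrow> bool" where
  "internal_cycle G D \<longleftrightarrow>
     (\<exists>C i. chain_order G C \<and> 2 \<le> i \<and> i + 1 \<le> chain_length G \<and> D = C i)"

definition in_position :: "'a graph \<Rightarrow> nat \<Rightarrow> 'a graph \<Rightarrow> bool" where
  "in_position G k C \<longleftrightarrow>
     (\<exists>u v. u \<noteq> v \<and> cut_vertices_in G C = {u, v} \<and> graph_dist C u v = k)"

definition meta_chain :: "nat \<Rightarrow> nat \<Rightarrow> 'a graph \<Rightarrow> bool" where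
  "meta_chain h n G \<longleftrightarrow> chain_h_cactus h G \<and> chain_length G = n \<and>
     (\<forall>C. internal_cycle G C \<longrightarrow> in_position G 2 C)"

end

theory Submission
  imports Defs
begin

text \<open>An independent set meets each of the \<open>n\<close> cycles in at most \<open>h div 2\<close> vertices, which gives
  the upper bound. Conversely, since the two cut vertices of an internal cycle are at distance 2,
  each cycle has an independent set of \<open>h div 2\<close> vertices avoiding its cut vertices; distinct cycles
  meet only in cut vertices, so the union of these sets is independent and of size \<open>n * (h div 2)\<close>.
  What remains is that every cycle with two cut vertices is internal for some chain order: in the
  relation ``having a common vertex'', the cycles have degree at most 2 and every link is a bridge,
  so a longest path runs through all cycles and ends in cycles of degree at most 1.\<close>

section \<open>Reachability\<close>

lemma adj_sym: "adj G u v \<longleftrightarrow> adj G v u"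
  by (simp add: adj_def insert_commute)

lemma reach_sym: "(adj G)\<^sup>*\<^sup>* x y \<Longrightarrow> (adj G)\<^sup>*\<^sup>* y x"
  by (induction rule: rtranclp_induct) (auto intro: converse_rtranclp_into_rtranclp adj_sym[THEN iffD1])

lemma reach_mono: "edges H \<subseteq> edges G \<Longrightarrow> (adj H)\<^sup>*\<^sup>* x y \<Longrightarrow> (adj G)\<^sup>*\<^sup>* x y"
  by (rule rtranclp_mono[THEN predicate2D]) (auto simp: adj_def)

lemma edges_delete_vertex_mono:
  "edges H \<subseteq> edges G \<Longrightarrow> edges (delete_vertex H v) \<subseteq> edges (delete_vertex G v)"
  by (auto simp: delete_vertex_def)

lemma edges_delete_vertex_subset: "edges (delete_vertex G v) \<subseteq> edges G"
  by (auto simp: delete_vertex_def)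

lemma adj_delete_vertex: "adj (delete_vertex G v) x y \<longleftrightarrow> adj G x y \<and> x \<noteq> v \<and> y \<noteq> v"
  by (auto simp: delete_vertex_def adj_def)

lemma simple_graph_adj:
  "simple_graph G \<Longrightarrow> adj G x y \<Longrightarrow> x \<noteq> y \<and> x \<in> verts G \<and> y \<in> verts G"
  by (fastforce simp: simple_graph_def adj_def)

text \<open>Repetitions are removed as the walk is extended at the front: if the new start
  \<open>x\<close> already occurs on the path, only the part from that occurrence on is
  kept.\<close>

lemma simple_path_exists:
  assumes "r\<^sup>*\<^sup>* x y"
  shows "\<exists>p. p \<noteq> [] \<and> hd p = x \<and> last p = y \<and> distinct p \<and> successively r p"
  using assms
proof (induction rule: converse_rtranclp_induct)
  case base
  show ?case by (rule exI[of _ "[y]"]) simp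
next
  case (step x z)
  then obtain p where p: "p \<noteq> []" "hd p = z" "last p = y" "distinct p" "successively r p" by auto
  show ?case
  proof (cases "x \<in> set p")
    case True
    then obtain as bs where "p = as @ x # bs" by (meson split_list)
    with p show ?thesis
      by (intro exI[of _ "x # bs"]) (auto simp: successively_append_iff)
  next
    case False
    with p step.hyps show ?thesis
      by (intro exI[of _ "x # p"]) (auto simp: successively_Cons)
  qed
qed

section \<open>Cycles\<close>

lemma verts_cycle_of_list [simp]: "verts (cycle_of_list vs) = set vs"
  by (simp add: cycle_of_list_def)

text \<open>Distinctness turns equality of vertices into equality of positions, so adjacency in a
  cycle becomes arithmetic modulo its length.\<close>

lemma adj_cycle_of_list_iff:
  assumes "distinct vs" "i < length vs" "j < length vs"
  shows "adj (cycle_of_list vs) (vs ! i) (vs ! j) \<longleftrightarrow>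
    j = Suc i mod length vs \<or> i = Suc j mod length vs"
proof -
  have *: "Suc k mod length vs < length vs" for k
    using assms by (intro mod_less_divisor) auto
  have "adj (cycle_of_list vs) (vs ! i) (vs ! j) \<longleftrightarrow>
    (\<exists>k<length vs. (i = k \<and> j = Suc k mod length vs) \<or> (i = Suc k mod length vs \<and> j = k))"
    using assms *
    by (auto simp: adj_def cycle_of_list_def doubleton_eq_iff nth_eq_iff_index_eq)
  with assms show ?thesis by blast
qed

text \<open>Position \<open>i\<close> of the rotated list is position
  \<open>(k + i) mod length vs\<close> of the original, and the cyclic successor commutes with this
  shift.\<close>

lemma edges_cycle_of_list_rotate_subset:
  "edges (cycle_of_list (rotate k vs)) \<subseteq> edges (cycle_of_list vs)"
proof
  fix e assume "e \<in> edges (cycle_of_list (rotate k vs))"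
  then obtain i where i: "i < length vs"
    "e = {rotate k vs ! i, rotate k vs ! (Suc i mod length vs)}"
    by (auto simp: cycle_of_list_def)
  let ?j = "(k + i) mod length vs"
  have pos: "0 < length vs" using i by auto
  have "e = {vs ! ?j, vs ! (Suc ?j mod length vs)}"
    using i pos by (simp add: nth_rotate mod_simps)
  moreover have "?j < length vs" using pos by simp
  ultimately show "e \<in> edges (cycle_of_list vs)" unfolding cycle_of_list_def by auto
qed

text \<open>Rotating on by \<open>length vs - k\<close> restores the list, so the inclusion for
  rotations also gives its converse.\<close>

lemma cycle_of_list_rotate:
  assumes "k \<le> length vs"
  shows "cycle_of_list (rotate k vs) = cycle_of_list vs"
proof -
  have "rotate (length vs - k) (rotate k vs) = vs"
    using assms by (simp add: rotate_rotate)
  then have "edges (cycle_of_list vs) \<subseteq> edges (cycle_of_list (rotate k vs))"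
    by (metis edges_cycle_of_list_rotate_subset)
  then show ?thesis
    using edges_cycle_of_list_rotate_subset[of k vs] by (intro graph.equality) auto
qed

lemma is_cycle_starting_at:
  assumes "is_cycle C" "v \<in> verts C"
  obtains vs where "distinct vs" "length vs \<ge> 3" "C = cycle_of_list vs" "vs ! 0 = v"
proof -
  obtain vs where vs: "distinct vs" "length vs \<ge> 3" "C = cycle_of_list vs"
    using assms unfolding is_cycle_def by auto
  then obtain k where k: "k < length vs" "vs ! k = v"
    using assms by (auto simp: in_set_conv_nth)
  show thesis
  proof (rule that[of "rotate k vs"])
    show "rotate k vs ! 0 = v" using k by (subst nth_rotate) auto
  qed (use vs k in \<open>auto simp: cycle_of_list_rotate\<close>)
qed

lemma card_verts_cycle: "is_cycle C \<Longrightarrow> card (verts C) \<ge> 3"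
  by (auto simp: is_cycle_def distinct_card)

text \<open>If \<open>v\<close> is on the cycle, it is rotated to position 0; the rest is then a
  path starting at \<open>vs ! 1\<close>, from which every remaining vertex is reached.\<close>

lemma cycle_delete_vertex_reach:
  assumes "is_cycle C" "x \<in> verts C - {v}" "y \<in> verts C - {v}"
  shows "(adj (delete_vertex C v))\<^sup>*\<^sup>* x y"
proof -
  obtain vs where vs: "distinct vs" "length vs \<ge> 3" "C = cycle_of_list vs" "v \<in> set vs \<Longrightarrow> vs ! 0 = v"
    using assms(1) is_cycle_starting_at[OF assms(1), of v] unfolding is_cycle_def
    by (metis verts_cycle_of_list)
  let ?R = "adj (delete_vertex C v)"
  have ne: "vs ! i \<noteq> v" if "0 < i" "i < length vs" for i
    using that vs nth_eq_iff_index_eq[of vs i 0] by (metis nth_mem less_trans nat_neq_iff)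
  have hub: "?R\<^sup>*\<^sup>* (vs ! 1) (vs ! i)" if "1 \<le> i" "i < length vs" for i
    using that
  proof (induction i rule: nat_induct_at_least)
    case base
    then show ?case by simp
  next
    case (Suc i)
    then have "?R (vs ! i) (vs ! Suc i)"
      using vs ne[of i] ne[of "Suc i"] by (simp add: adj_delete_vertex adj_cycle_of_list_iff)
    with Suc show ?case by (simp add: rtranclp.rtrancl_into_rtrancl)
  qed
  have "?R\<^sup>*\<^sup>* (vs ! 1) z" if z: "z \<in> verts C - {v}" for z
  proof -
    obtain i where i: "i < length vs" "z = vs ! i" using z vs by (auto simp: in_set_conv_nth)
    show ?thesis
    proof (cases "i = 0")
      \<comment> \<open>Position 0 survives only if \<open>v\<close> is off the cycle; then
        \<open>vs ! 0\<close> is itself a neighbour of \<open>vs ! 1\<close>.\<close>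
      case True
      with i z vs ne[of 1] have "?R (vs ! 1) z"
        by (simp add: adj_delete_vertex adj_cycle_of_list_iff)
      then show ?thesis by blast
    next
      case False
      with i hub show ?thesis by simp
    qed
  qed
  with assms show ?thesis by (meson reach_sym rtranclp_trans)
qed

text \<open>Deleting a vertex leaves the others mutually reachable, which excludes cut vertices. It
  also gives connectedness: of at least three vertices, one differs from both given ends and can be
  the deleted one.\<close>

lemma nonseparable_cycle:
  assumes "is_cycle C"
  shows "nonseparable C"
proof -
  have "(adj C)\<^sup>*\<^sup>* x y" if "x \<in> verts C" "y \<in> verts C" for x y
  proof -
    have "\<not> verts C \<subseteq> {x, y}"
    proof
      assume "verts C \<subseteq> {x, y}"
      then have "card (verts C) \<le> card {x, y}" by (intro card_mono) auto
      also have "\<dots> \<le> 2" by (simp add: card_insert_if)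
      finally show False using card_verts_cycle[OF assms] by simp
    qed
    then obtain v where "v \<in> verts C" "v \<noteq> x" "v \<noteq> y" by auto
    with that assms have "(adj (delete_vertex C v))\<^sup>*\<^sup>* x y"
      by (intro cycle_delete_vertex_reach) auto
    then show ?thesis by (rule reach_mono[OF edges_delete_vertex_subset])
  qed
  moreover have "verts C \<noteq> {}" using card_verts_cycle[OF assms] by auto
  ultimately show ?thesis
    using cycle_delete_vertex_reach[OF assms]
    unfolding nonseparable_def connected_graph_def cut_vertex_def by blast
qed

lemma cycle_neighbour:
  assumes "is_cycle C" "v \<in> verts C"
  obtains w where "adj C v w"
proof -
  obtain vs where vs: "distinct vs" "length vs \<ge> 3" "C = cycle_of_list vs" "vs ! 0 = v"
    by (rule is_cycle_starting_at[OF assms])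
  moreover have "0 < length vs" "1 < length vs" using vs(2) by auto
  ultimately have "adj C (vs ! 0) (vs ! 1)" using adj_cycle_of_list_iff[of vs 0 1] by auto
  with vs have "adj C v (vs ! 1)" by simp
  then show thesis by (rule that)
qed

text \<open>The cyclic successor maps the positions of an independent set injectively to the positions
  outside it.\<close>
lemma card_independent_in_cycle:
  assumes "is_cycle C" "S \<subseteq> verts C" "\<And>x y. x \<in> S \<Longrightarrow> y \<in> S \<Longrightarrow> \<not> adj C x y"
  shows "card S \<le> card (verts C) div 2"
proof -
  obtain vs where vs: "distinct vs" "length vs \<ge> 3" "C = cycle_of_list vs"
    using assms(1) unfolding is_cycle_def by auto
  let ?n = "length vs"
  define I where "I = {i. i < ?n \<and> vs ! i \<in> S}"
  let ?s = "\<lambda>i. Suc i mod ?n"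
  have "S \<subseteq> (!) vs ` I"
  proof
    fix x assume "x \<in> S"
    with assms(2) vs(3) obtain i where "i < ?n" "x = vs ! i"
      by (auto simp: in_set_conv_nth dest!: subsetD)
    with \<open>x \<in> S\<close> show "x \<in> (!) vs ` I" by (auto simp: I_def)
  qed
  then have "card S \<le> card I" by (rule surj_card_le[rotated]) (simp add: I_def)
  have inj: "inj_on ?s I"
    by (rule inj_onI) (auto simp: I_def mod_Suc split: if_splits)
  have sub: "?s ` I \<subseteq> {..<?n}" "I \<subseteq> {..<?n}"
    using vs(2) by (auto simp: I_def intro!: mod_less_divisor)
  have "?s i \<notin> I" if "i \<in> I" for i
  proof
    assume "?s i \<in> I"
    with that have "adj C (vs ! i) (vs ! ?s i)"
      using adj_cycle_of_list_iff[of vs i "?s i"] vs by (auto simp: I_def)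
    with assms(3) that \<open>?s i \<in> I\<close> show False by (auto simp: I_def)
  qed
  then have disj: "I \<inter> ?s ` I = {}" by auto
  have fin: "finite I" using sub(2) finite_subset by blast
  have "card I + card I = card (I \<union> ?s ` I)"
    using disj fin by (simp add: card_Un_disjoint card_image[OF inj])
  also have "\<dots> \<le> card {..<?n}" using sub by (intro card_mono) auto
  finally have "2 * card I \<le> card (verts C)" using vs by (simp add: distinct_card)
  with \<open>card S \<le> card I\<close> show ?thesis by simp
qed

lemma card_odd_lessThan: "card {i. i < n \<and> odd i} = n div 2"
proof (induction n)
  case (Suc n)
  have "{i. i < Suc n \<and> odd i} = (if odd n then insert n {i. i < n \<and> odd i} else {i. i < n \<and> odd i})"
    by (auto simp: less_Suc_eq)
  with Suc show ?case by (auto elim: oddE evenE)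
qed simp

text \<open>Put \<open>u\<close> at position 0. If \<open>v\<close> has an even position, the odd positions avoid both; otherwise
  the length is odd and the nonzero even positions do.\<close>
lemma large_independent_avoiding:
  assumes "is_cycle C" "u \<in> verts C" "v \<in> verts C" "adj C u w" "adj C w v" "w \<in> verts C"
  obtains S where "S \<subseteq> verts C - {u, v}" "card S = card (verts C) div 2"
    "\<And>x y. x \<in> S \<Longrightarrow> y \<in> S \<Longrightarrow> \<not> adj C x y"
proof -
  note result = that
  obtain vs where vs: "distinct vs" "length vs \<ge> 3" "C = cycle_of_list vs" "vs ! 0 = u"
    by (rule is_cycle_starting_at[OF assms(1,2)])
  let ?n = "length vs"
  have pos: "0 < ?n" using vs(2) by auto
  obtain j k where jk: "j < ?n" "vs ! j = v" "k < ?n" "vs ! k = w"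
    using assms vs by (auto simp: in_set_conv_nth)
  \<comment> \<open>An even cycle is bipartite by the parity of positions; the wrap-around edge
    joins the odd position \<open>?n - 1\<close> to 0.\<close>
  have flip: "odd a \<longleftrightarrow> even b" if "even ?n" "a < ?n" "b < ?n" "adj C (vs ! a) (vs ! b)" for a b
    using that vs even_Suc[of a] even_Suc[of b]
    by (auto simp: adj_cycle_of_list_iff mod_Suc simp del: even_Suc split: if_splits)
  \<comment> \<open>Two steps, from \<open>u\<close> at position 0 via \<open>w\<close> to
    \<open>v\<close>, flip the parity twice.\<close>
  have even_j: "even j" if "even ?n"
    using flip[OF that pos jk(3)] flip[OF that jk(3,1)] jk assms(4,5) vs(4) by simp
  \<comment> \<open>Consecutive positions differ in parity, except possibly across the wrap-around
    edge, which is excluded because position 0 is.\<close>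
  have indep: "\<not> adj C (vs ! a) (vs ! b)"
    if "a < ?n" "b < ?n" "0 < a" "0 < b" "odd a \<longleftrightarrow> odd b" for a b
    using that vs by (auto simp: adj_cycle_of_list_iff mod_Suc split: if_splits)
  \<comment> \<open>It remains to choose \<open>?n div 2\<close> nonzero positions of one parity
    other than \<open>j\<close>.\<close>
  have goal: thesis
    if I: "I \<subseteq> {0<..<?n}" "j \<notin> I" "card I = ?n div 2" "\<And>a b. a \<in> I \<Longrightarrow> b \<in> I \<Longrightarrow> odd a \<longleftrightarrow> odd b" for I
  proof (rule result[of "(!) vs ` I"])
    have "inj_on ((!) vs) I"
      using I(1) vs(1) by (auto simp: inj_on_def nth_eq_iff_index_eq subset_iff)
    then show "card ((!) vs ` I) = card (verts C) div 2"
      using I(3) vs by (simp add: card_image distinct_card)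
    have "vs ! a \<noteq> u \<and> vs ! a \<noteq> v" if "a \<in> I" for a
    proof -
      from that I have "a < ?n" "a \<noteq> 0" "a \<noteq> j" by auto
      with nth_eq_iff_index_eq[OF vs(1) _ pos, of a] nth_eq_iff_index_eq[OF vs(1) _ jk(1), of a]
      show ?thesis using vs(4) jk(2) by simp
    qed
    then show "(!) vs ` I \<subseteq> verts C - {u, v}" using vs I(1) by auto
    show "\<not> adj C x y" if "x \<in> (!) vs ` I" "y \<in> (!) vs ` I" for x y
    proof -
      from that obtain a b where "a \<in> I" "b \<in> I" "x = vs ! a" "y = vs ! b" by blast
      moreover from this have "a \<in> {0<..<?n}" "b \<in> {0<..<?n}" using I(1) by blast+
      ultimately show ?thesis using indep[of a b] I(4)[of a b] by simp
    qed
  qed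
  show thesis
  proof (cases "even j")
    case True
    then show ?thesis
      by (intro goal[of "{i. i < ?n \<and> odd i}"]) (auto simp: card_odd_lessThan odd_pos)
  next
    case False
    then have "odd ?n" using even_j by blast
    \<comment> \<open>Shifting by one reduces the count to that of odd numbers;
      \<open>(?n - 1) div 2\<close> loses nothing since \<open>?n\<close> is odd.\<close>
    have "{i. 0 < i \<and> i < ?n \<and> even i} = Suc ` {i. i < ?n - 1 \<and> odd i}"
    proof (intro equalityI subsetI)
      fix i assume "i \<in> {i. 0 < i \<and> i < ?n \<and> even i}"
      then show "i \<in> Suc ` {i. i < ?n - 1 \<and> odd i}" by (cases i) auto
    qed auto
    then have "card {i. 0 < i \<and> i < ?n \<and> even i} = (?n - 1) div 2"
      by (simp add: card_image card_odd_lessThan)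
    also have "\<dots> = ?n div 2" using \<open>odd ?n\<close> by (auto elim!: oddE)
    finally show ?thesis using False
      by (intro goal[of "{i. 0 < i \<and> i < ?n \<and> even i}"]) auto
  qed
qed

section \<open>Blocks\<close>

lemma finite_edges: "simple_graph G \<Longrightarrow> finite (edges G)"
  unfolding simple_graph_def by (rule finite_subset[of _ "Pow (verts G)"]) auto

text \<open>Among the nonseparable subgraphs containing \<open>H\<close>, one with the most vertices
  and edges together is maximal: a nonseparable extension has equal counts, hence is the same
  graph.\<close>

lemma ex_block_containing:
  assumes "simple_graph G" "subgraph H G" "nonseparable H"
  obtains B where "block G B" "subgraph H B"
proof -
  let ?P = "\<lambda>B. subgraph B G \<and> nonseparable B \<and> subgraph H B"
  let ?m = "\<lambda>B. card (verts B) + card (edges B)"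
  have fin: "finite (verts G)" "finite (edges G)"
    using assms(1) finite_edges by (auto simp: simple_graph_def)
  have "?P H" using assms by (auto simp: subgraph_def)
  moreover have "?m B \<le> ?m G" if "?P B" for B
    using that fin by (intro add_mono card_mono) (auto simp: subgraph_def)
  ultimately have "\<exists>B. ?P B \<and> (\<forall>D. ?P D \<longrightarrow> ?m D \<le> ?m B)"
    by (intro ex_has_greatest_nat[of ?P H ?m "Suc (?m G)"]) (auto simp: less_Suc_eq_le)
  then obtain B where B: "?P B" "\<And>D. ?P D \<Longrightarrow> ?m D \<le> ?m B" by metis
  have "D = B" if D: "subgraph D G" "nonseparable D" "subgraph B D" for D
  proof -
    have "?m D \<le> ?m B" using B D by (intro B(2)) (auto simp: subgraph_def)
    moreover have le: "verts B \<subseteq> verts D" "edges B \<subseteq> edges D" using D by (auto simp: subgraph_def)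
    moreover have f: "finite (verts D)" "finite (edges D)"
      using D fin by (auto simp: subgraph_def intro: finite_subset)
    ultimately have "card (verts D) \<le> card (verts B)" "card (edges D) \<le> card (edges B)"
      using card_mono[OF f(1) le(1)] card_mono[OF f(2) le(2)] by linarith+
    with le f have "verts B = verts D" "edges B = edges D" by (simp_all add: card_seteq)
    then show ?thesis by (intro graph.equality) auto
  qed
  with B have "block G B" by (auto simp: block_def)
  with B that show thesis by blast
qed

text \<open>Serves to place every edge in a block. No vertex is a cut vertex, since deleting either
  end leaves just one vertex.\<close>

lemma nonseparable_single_edge:
  "nonseparable \<lparr>verts = {u, v}, edges = {{u, v}}\<rparr>" (is "nonseparable ?H")
proof -
  have "adj ?H u v" "adj ?H v u" by (simp_all add: adj_def insert_commute)
  then have "(adj ?H)\<^sup>*\<^sup>* x y" if "x \<in> {u, v}" "y \<in> {u, v}" for x y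
    using that by blast
  then have "connected_graph ?H" unfolding connected_graph_def by simp
  moreover have "\<not> cut_vertex ?H z" for z
  proof
    assume "cut_vertex ?H z"
    then obtain x y where "z \<in> verts ?H" "x \<in> verts ?H - {z}" "y \<in> verts ?H - {z}"
      "\<not> (adj (delete_vertex ?H z))\<^sup>*\<^sup>* x y"
      unfolding cut_vertex_def by blast
    moreover from this have "x = y" by auto
    ultimately show False by simp
  qed
  ultimately show ?thesis by (simp add: nonseparable_def)
qed

section \<open>Chain cacti\<close>

lemma chain_cactusD:
  assumes "chain_cactus G"
  shows chain_cactus_simple: "simple_graph G"
    and chain_cactus_connected: "connected_graph G"
    and chain_cactus_cycle_unique:
      "\<And>e C D. e \<in> edges C \<Longrightarrow> e \<in> edges D \<Longrightarrow> C \<in> cycles G \<Longrightarrow> D \<in> cycles G \<Longrightarrow> C = D"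
    and chain_cactus_block: "\<And>B. block G B \<Longrightarrow> B \<in> cycles G \<and> card (cut_vertices_in G B) \<le> 2"
    and chain_cactus_cut: "\<And>v. cut_vertex G v \<Longrightarrow> card {C \<in> cycles G. v \<in> verts C} = 2"
proof -
  have c: "cactus G"
    and b: "\<And>B. block G B \<Longrightarrow> is_cycle B \<and> card (cut_vertices_in G B) \<le> 2"
    and v: "\<And>v. cut_vertex G v \<Longrightarrow> card {C \<in> cycles G. v \<in> verts C} = 2"
    using assms unfolding chain_cactus_def by blast+
  show "simple_graph G" "connected_graph G" using c by (simp_all add: cactus_def)
  show "C = D" if "e \<in> edges C" "e \<in> edges D" "C \<in> cycles G" "D \<in> cycles G" for e C D
  proof -
    have "e \<in> edges G" using that by (auto simp: cycles_def subgraph_def)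
    with c that show ?thesis unfolding cactus_def by blast
  qed
  show "B \<in> cycles G \<and> card (cut_vertices_in G B) \<le> 2" if "block G B" for B
    using b[OF that] that by (simp add: cycles_def block_def)
  show "card {C \<in> cycles G. v \<in> verts C} = 2" if "cut_vertex G v" for v
    by (rule v[OF that])
qed

lemma cycles_is_cycle: "C \<in> cycles G \<Longrightarrow> is_cycle C"
  and cycles_verts: "C \<in> cycles G \<Longrightarrow> verts C \<subseteq> verts G"
  and cycles_edges: "C \<in> cycles G \<Longrightarrow> edges C \<subseteq> edges G"
  and cycles_simple: "C \<in> cycles G \<Longrightarrow> simple_graph C"
  by (auto simp: cycles_def subgraph_def)

lemma cycles_adj: "C \<in> cycles G \<Longrightarrow> adj C x y \<Longrightarrow> x \<noteq> y \<and> x \<in> verts C \<and> y \<in> verts C"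
  by (rule simple_graph_adj[OF cycles_simple])

text \<open>A single edge is nonseparable, so it lies in a block, and all blocks are cycles.\<close>

lemma edge_in_cycle:
  assumes "chain_cactus G" "adj G x y"
  obtains C where "C \<in> cycles G" "adj C x y"
proof -
  note simple = chain_cactus_simple[OF assms(1)]
  let ?H = "\<lparr>verts = {x, y}, edges = {{x, y}}\<rparr>"
  have "subgraph ?H G"
    using simple simple_graph_adj[OF simple assms(2)] assms(2)
    by (auto simp: subgraph_def simple_graph_def adj_def)
  then obtain B where B: "block G B" "subgraph ?H B"
    by (rule ex_block_containing[OF simple _ nonseparable_single_edge])
  have "adj B x y" using B(2) by (simp add: subgraph_def adj_def)
  with chain_cactus_block[OF assms(1) B(1)] that show thesis by blast
qed

text \<open>The definition bounds the cut vertices of blocks only. A cycle lies in some block, which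
  is itself a cycle; sharing an edge, the two coincide.\<close>

lemma card_cut_vertices_in_cycle:
  assumes "chain_cactus G" "C \<in> cycles G"
  shows "card (cut_vertices_in G C) \<le> 2"
proof -
  have C: "subgraph C G" "is_cycle C" using assms by (auto simp: cycles_def)
  obtain B where B: "block G B" "subgraph C B"
    using ex_block_containing[OF chain_cactus_simple[OF assms(1)] C(1) nonseparable_cycle[OF C(2)]] .
  obtain v where "v \<in> verts C" using card_verts_cycle[OF C(2)] by fastforce
  then obtain w where "adj C v w" using cycle_neighbour[OF C(2)] by blast
  then have "{v, w} \<in> edges C" "{v, w} \<in> edges B" using B by (auto simp: subgraph_def adj_def)
  then have "C = B"
    using chain_cactus_cycle_unique chain_cactus_block assms B by blast
  with B chain_cactus_block[OF assms(1)] show ?thesis by blast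
qed

text \<open>If a common vertex of two cycles were not a cut vertex, a path avoiding it between its
  neighbours on the two cycles would close up to a third cycle sharing an edge with both.\<close>
lemma common_vertex_is_cut:
  assumes "chain_cactus G" "C \<in> cycles G" "D \<in> cycles G" "C \<noteq> D" "v \<in> verts C" "v \<in> verts D"
  shows "cut_vertex G v"
proof (rule ccontr)
  assume nc: "\<not> cut_vertex G v"
  note simple = chain_cactus_simple[OF assms(1)]
  obtain x where x: "adj C v x" using cycle_neighbour assms(2,5) cycles_is_cycle by metis
  obtain y where y: "adj D v y" using cycle_neighbour assms(3,6) cycles_is_cycle by metis
  have xG: "adj G v x" and yG: "adj G v y"
    using x y cycles_edges assms(2,3) by (fastforce simp: adj_def)+
  \<comment> \<open>Otherwise the edge from \<open>v\<close> to \<open>x\<close> would lie in both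
    \<open>C\<close> and \<open>D\<close>.\<close>
  have "x \<noteq> y" using x y assms(2-4) chain_cactus_cycle_unique[OF assms(1)] by (auto simp: adj_def)
  have "x \<in> verts G" "y \<in> verts G" "v \<in> verts G" "x \<noteq> v" "y \<noteq> v"
    using simple_graph_adj[OF simple xG] simple_graph_adj[OF simple yG] by auto
  then have "(adj (delete_vertex G v))\<^sup>*\<^sup>* x y"
    using nc chain_cactus_connected[OF assms(1)] unfolding cut_vertex_def connected_graph_def by blast
  then obtain p where p: "p \<noteq> []" "hd p = x" "last p = y" "distinct p"
    "successively (adj (delete_vertex G v)) p"
    using simple_path_exists by metis
  obtain p' where p': "p = x # p'" "p' \<noteq> []"
    using p(1-3) \<open>x \<noteq> y\<close> by (cases p) (auto split: if_splits)
  have step: "adj (delete_vertex G v) (p ! i) (p ! Suc i)" if "Suc i < length p" for i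
    using p(5) that by (simp add: successively_conv_nth)
  have notv: "p ! i \<noteq> v" if "i < length p" for i
  proof (cases i)
    case 0
    then show ?thesis using p' \<open>x \<noteq> v\<close> by simp
  next
    case (Suc k)
    then show ?thesis using step[of k] that by (simp add: adj_delete_vertex)
  qed
  then have "v \<notin> set p" by (auto simp: in_set_conv_nth)
  let ?vs = "v # p"
  let ?E = "cycle_of_list ?vs"
  have len: "length ?vs \<ge> 3" using p' by (cases p') auto
  have last: "p ! (length p - 1) = y" using p by (simp add: last_conv_nth)
  \<comment> \<open>The edges of the closed walk are the one from \<open>v\<close> to
    \<open>x\<close>, those of the path, and the closing one from \<open>y\<close> back to
    \<open>v\<close>.\<close>
  have sub: "adj G (?vs ! i) (?vs ! (Suc i mod length ?vs))" if i: "i < length ?vs" for i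
  proof -
    consider "i = 0" | k where "i = Suc k" "Suc k < length p" | "i = length p"
      using i by (cases i) (auto simp: less_Suc_eq)
    then show ?thesis
    proof cases
      case 1
      then show ?thesis using xG p' by simp
    next
      case 2
      then show ?thesis using step[of k] by (simp add: adj_delete_vertex)
    next
      case 3
      then show ?thesis using yG last p(1) by (simp add: adj_sym nth_Cons')
    qed
  qed
  have "e \<in> edges G" if "e \<in> edges ?E" for e
  proof -
    from that obtain i where "i < length ?vs" "e = {?vs ! i, ?vs ! (Suc i mod length ?vs)}"
      unfolding cycle_of_list_def by auto
    with sub show ?thesis by (simp only: adj_def)
  qed
  then have es: "edges ?E \<subseteq> edges G" by blast
  have "a \<in> verts G" if "a \<in> set ?vs" for a
  proof -
    obtain i where "i < length ?vs" "a = ?vs ! i" using \<open>a \<in> set ?vs\<close> by (metis in_set_conv_nth)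
    with simple_graph_adj[OF simple sub] show ?thesis by blast
  qed
  then have vsub: "verts ?E \<subseteq> verts G" by auto
  have "e \<subseteq> verts ?E" if "e \<in> edges ?E" for e
  proof -
    from that obtain i where i: "i < length ?vs" "e = {?vs ! i, ?vs ! (Suc i mod length ?vs)}"
      unfolding cycle_of_list_def by auto
    moreover have "Suc i mod length ?vs < length ?vs" by (rule mod_less_divisor) simp
    ultimately show ?thesis by (simp only: verts_cycle_of_list) (meson empty_subsetI insert_subset nth_mem)
  qed
  then have "simple_graph ?E"
    using es simple by (auto simp: simple_graph_def)
  moreover have "is_cycle ?E"
    unfolding is_cycle_def using len p(4) \<open>v \<notin> set p\<close> by (intro exI[of _ ?vs]) auto
  ultimately have E: "?E \<in> cycles G" using es vsub by (simp add: cycles_def subgraph_def)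
  have dist: "distinct ?vs" using p(4) \<open>v \<notin> set p\<close> by simp
  have "adj ?E v x" using adj_cycle_of_list_iff[OF dist, of 0 1] p' by auto
  moreover have "adj ?E v y"
    using adj_cycle_of_list_iff[OF dist, of 0 "length p"] p(1) last by (auto simp: nth_Cons')
  \<comment> \<open>The new cycle shares the edge to \<open>x\<close> with \<open>C\<close> and the
    edge to \<open>y\<close> with \<open>D\<close>.\<close>
  ultimately have "?E = C" "?E = D"
    using x y assms(2,3) E chain_cactus_cycle_unique[OF assms(1)] unfolding adj_def by blast+
  with assms(4) show False by simp
qed

lemma cycles_through_cut_vertex:
  assumes "chain_cactus G" "cut_vertex G v" "C \<in> cycles G" "D \<in> cycles G" "C \<noteq> D"
    "v \<in> verts C" "v \<in> verts D" "E \<in> cycles G" "v \<in> verts E"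
  shows "E = C \<or> E = D"
proof (rule ccontr)
  let ?A = "{C \<in> cycles G. v \<in> verts C}"
  assume "\<not> ?thesis"
  then have "card {C, D, E} = 3" using assms(5) by auto
  moreover have "card ?A = 2" by (rule chain_cactus_cut[OF assms(1,2)])
  \<comment> \<open>An infinite set would have cardinality 0, not 2.\<close>
  moreover have "finite ?A" using calculation(2) by (intro card_ge_0_finite) simp
  moreover have "{C, D, E} \<subseteq> ?A" using assms by auto
  ultimately show False using card_mono[of ?A "{C, D, E}"] by linarith
qed

lemma cycle_reach_delete_vertex:
  assumes "C \<in> cycles G" "x \<in> verts C" "y \<in> verts C" "x \<noteq> v" "y \<noteq> v"
  shows "(adj (delete_vertex G v))\<^sup>*\<^sup>* x y"
  using cycle_delete_vertex_reach[OF cycles_is_cycle[OF assms(1)], of x v y] assms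
    reach_mono[OF edges_delete_vertex_mono[OF cycles_edges[OF assms(1)]]] by auto

text \<open>All neighbours of the cut vertex lie on its two cycles, so a connection between these
  would bypass it.\<close>
lemma cut_vertex_separates_cycles:
  assumes "chain_cactus G" "cut_vertex G v" "C \<in> cycles G" "D \<in> cycles G" "C \<noteq> D"
    "v \<in> verts C" "v \<in> verts D" "x \<in> verts C" "y \<in> verts D" "x \<noteq> v" "y \<noteq> v"
  shows "\<not> (adj (delete_vertex G v))\<^sup>*\<^sup>* x y"
proof
  let ?R = "adj (delete_vertex G v)"
  assume xy: "?R\<^sup>*\<^sup>* x y"
  have nb: "?R\<^sup>*\<^sup>* x a" if a: "adj G v a" for a
  proof -
    obtain E where E: "E \<in> cycles G" "adj E v a" by (rule edge_in_cycle[OF assms(1) a])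
    have aE: "a \<noteq> v" "v \<in> verts E" "a \<in> verts E"
      using cycles_adj[OF E] by auto
    have "E = C \<or> E = D" by (rule cycles_through_cut_vertex[OF assms(1-7) E(1) aE(2)])
    then show ?thesis
    proof
      assume "E = C"
      with assms aE show ?thesis by (intro cycle_reach_delete_vertex[of C]) auto
    next
      assume "E = D"
      with assms aE have "?R\<^sup>*\<^sup>* y a" by (intro cycle_reach_delete_vertex[of D]) auto
      with xy show ?thesis by simp
    qed
  qed
  \<comment> \<open>Follows a walk of \<open>G\<close> that starts away from \<open>v\<close>. While
    it stands on \<open>v\<close>, only reachability of \<open>x\<close> is recorded; from
    \<open>x\<close> every neighbour of \<open>v\<close> is reachable, so the walk can be resumed.
    Thus deleting \<open>v\<close> separates nothing.\<close>
  have "(b \<noteq> v \<longrightarrow> ?R\<^sup>*\<^sup>* a b) \<and> (b = v \<longrightarrow> ?R\<^sup>*\<^sup>* a x)" if "(adj G)\<^sup>*\<^sup>* a b" "a \<noteq> v" for a b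
    using that
  proof (induction rule: rtranclp_induct)
    case (step b c)
    show ?case
    proof (cases "b = v")
      case True
      with step.IH step.prems have "?R\<^sup>*\<^sup>* a x" by simp
      moreover have "c \<noteq> v" "?R\<^sup>*\<^sup>* x c"
        using True nb[of c] simple_graph_adj[OF chain_cactus_simple[OF assms(1)] step.hyps(2)]
          step.hyps(2) by auto
      ultimately show ?thesis by simp
    next
      case False
      have ab: "?R\<^sup>*\<^sup>* a b" using step.IH step.prems False by simp
      show ?thesis
      proof (cases "c = v")
        case True
        then have "?R\<^sup>*\<^sup>* x b" using nb step.hyps(2) adj_sym by metis
        with ab True show ?thesis using reach_sym rtranclp_trans by metis
      next
        case neq: False
        with step.hyps(2) False have "?R b c" by (simp add: adj_delete_vertex)
        with ab neq show ?thesis by (simp add: rtranclp.rtrancl_into_rtrancl)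
      qed
    qed
  qed auto
  with assms(2) show False unfolding cut_vertex_def by blast
qed

text \<open>A second common vertex \<open>u\<close> would connect the two cycles without
  \<open>v\<close> by the trivial walk from \<open>u\<close> to itself.\<close>

lemma common_vertices_singleton:
  assumes "chain_cactus G" "C \<in> cycles G" "D \<in> cycles G" "C \<noteq> D" "v \<in> verts C" "v \<in> verts D"
  shows "verts C \<inter> verts D = {v}"
proof -
  note cut = common_vertex_is_cut[OF assms]
  have "u = v" if "u \<in> verts C" "u \<in> verts D" for u
  proof (rule ccontr)
    assume "u \<noteq> v"
    from cut_vertex_separates_cycles[OF assms(1) cut assms(2-6) that this this] show False by simp
  qed
  with assms(5,6) show ?thesis by blast
qed

section \<open>The order along the chain\<close>

text \<open>The edge relation of the intersection graph of the cycles; \<open>C \<noteq> D\<close>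
  excludes loops.\<close>

definition meets :: "'a graph \<Rightarrow> 'a graph \<Rightarrow> 'a graph \<Rightarrow> bool" where
  "meets G C D \<longleftrightarrow> C \<in> cycles G \<and> D \<in> cycles G \<and> C \<noteq> D \<and> verts C \<inter> verts D \<noteq> {}"

lemma meets_sym: "meets G C D \<longleftrightarrow> meets G D C"
  by (auto simp: meets_def)

lemma meets_common_cut_vertex:
  assumes "chain_cactus G" "meets G C D"
  obtains v where "cut_vertex G v" "verts C \<inter> verts D = {v}"
proof -
  obtain v where v: "v \<in> verts C" "v \<in> verts D" using assms by (auto simp: meets_def)
  have CD: "C \<in> cycles G" "D \<in> cycles G" "C \<noteq> D" using assms by (auto simp: meets_def)
  show thesis
    by (rule that[OF common_vertex_is_cut[OF assms(1) CD v] common_vertices_singleton[OF assms(1) CD v]])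
qed

text \<open>Each neighbour of \<open>C\<close> corresponds to its one common vertex with
  \<open>C\<close>. This is injective because only two cycles pass through a cut vertex, and
  surjective because a second cycle does pass through it.\<close>

lemma card_meets_eq_cut_vertices:
  fixes G :: "'a graph"
  assumes "chain_cactus G" "C \<in> cycles G"
  shows "card {D. meets G C D} = card (cut_vertices_in G C)"
proof -
  define f where "f = (\<lambda>D :: 'a graph. THE v. verts C \<inter> verts D = {v})"
  have f: "cut_vertex G (f D) \<and> verts C \<inter> verts D = {f D}" if m: "meets G C D" for D
  proof -
    obtain v where v: "cut_vertex G v" "verts C \<inter> verts D = {v}"
      by (rule meets_common_cut_vertex[OF assms(1) m])
    then have "f D = v" by (auto simp: f_def)
    with v show ?thesis by simp
  qed
  have "bij_betw f {D. meets G C D} (cut_vertices_in G C)"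
  proof (rule bij_betw_imageI)
    show "inj_on f {D. meets G C D}"
    proof (rule inj_onI)
      fix D E assume "D \<in> {D. meets G C D}" "E \<in> {D. meets G C D}" and eq: "f D = f E"
      then have m: "meets G C D" "meets G C E" by auto
      show "D = E"
        using cycles_through_cut_vertex[OF assms(1), of "f D" C D E] f[OF m(1)] f[OF m(2)] eq m
        by (auto simp: meets_def)
    qed
    show "f ` {D. meets G C D} = cut_vertices_in G C"
    proof (intro equalityI subsetI)
      fix v assume "v \<in> f ` {D. meets G C D}"
      then show "v \<in> cut_vertices_in G C" using f by (auto simp: cut_vertices_in_def)
    next
      fix v assume v: "v \<in> cut_vertices_in G C"
      let ?A = "{D \<in> cycles G. v \<in> verts D}"
      have "card ?A = 2" using v chain_cactus_cut[OF assms(1)] by (auto simp: cut_vertices_in_def)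
      then have "\<not> ?A \<subseteq> {C}" using card_mono[of "{C}" ?A] by auto
      then obtain D where "D \<in> cycles G" "v \<in> verts D" "D \<noteq> C" by auto
      with v assms have "meets G C D" "v \<in> verts C \<inter> verts D"
        by (auto simp: meets_def cut_vertices_in_def)
      with f show "v \<in> f ` {D. meets G C D}" by blast
    qed
  qed
  then show ?thesis by (rule bij_betw_same_card)
qed

text \<open>Connectedness of \<open>G\<close> carries over to its cycles: along a walk from a cycle
  of \<open>A\<close>, each edge lies in a cycle that shares a vertex with a cycle of
  \<open>A\<close>, and so belongs to \<open>A\<close>.\<close>

lemma meets_closed_eq_cycles:
  assumes "chain_cactus G" "A \<subseteq> cycles G" "A \<noteq> {}"
    and closed: "\<And>C D. C \<in> A \<Longrightarrow> meets G C D \<Longrightarrow> D \<in> A"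
  shows "A = cycles G"
proof -
  have absorb: "D \<in> A" if "C \<in> A" "D \<in> cycles G" "v \<in> verts C" "v \<in> verts D" for C D v
    using that assms(2) closed[of C D] by (cases "C = D") (auto simp: meets_def)
  obtain C0 where "C0 \<in> A" using assms(3) by blast
  then have "is_cycle C0" using assms(2) cycles_is_cycle by blast
  then obtain a where a: "a \<in> verts C0" using card_verts_cycle by fastforce
  have reach: "\<exists>C\<in>A. b \<in> verts C" if "(adj G)\<^sup>*\<^sup>* a b" for b
    using that
  proof (induction rule: rtranclp_induct)
    case base
    then show ?case using a \<open>C0 \<in> A\<close> by blast
  next
    case (step b c)
    then obtain C where C: "C \<in> A" "b \<in> verts C" by blast
    obtain E where E: "E \<in> cycles G" "adj E b c" by (rule edge_in_cycle[OF assms(1) step.hyps(2)])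
    have "b \<in> verts E" "c \<in> verts E" using cycles_adj[OF E] by auto
    with absorb C E show ?case by blast
  qed
  have "D \<in> A" if D: "D \<in> cycles G" for D
  proof -
    obtain b where b: "b \<in> verts D" using card_verts_cycle[OF cycles_is_cycle[OF D]] by fastforce
    have "(adj G)\<^sup>*\<^sup>* a b"
      using chain_cactus_connected[OF assms(1)] a b D \<open>C0 \<in> A\<close> assms(2) cycles_verts
      unfolding connected_graph_def by blast
    with reach absorb D b show ?thesis by blast
  qed
  with assms(2) show ?thesis by blast
qed

text \<open>A detour from \<open>C\<close> to \<open>D\<close> through other links would connect
  them in \<open>G\<close> without their common cut vertex \<open>v\<close>.\<close>

lemma meets_bridge:
  assumes "chain_cactus G" "meets G C D"
  shows "\<not> (\<lambda>A B. meets G A B \<and> {A, B} \<noteq> {C, D})\<^sup>*\<^sup>* C D"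
proof
  assume path: "(\<lambda>A B. meets G A B \<and> {A, B} \<noteq> {C, D})\<^sup>*\<^sup>* C D" (is "?P\<^sup>*\<^sup>* C D")
  obtain v where v: "cut_vertex G v" "verts C \<inter> verts D = {v}"
    by (rule meets_common_cut_vertex[OF assms])
  have CD: "C \<in> cycles G" "D \<in> cycles G" "C \<noteq> D" "v \<in> verts C" "v \<in> verts D"
    using assms(2) v by (auto simp: meets_def)
  have other: "\<exists>x. x \<in> verts E \<and> x \<noteq> v" if "E \<in> cycles G" for E
  proof -
    have "\<not> verts E \<subseteq> {v}"
      using card_verts_cycle[OF cycles_is_cycle[OF that]] card_mono[of "{v}" "verts E"] by auto
    then show ?thesis by blast
  qed
  obtain x where x: "x \<in> verts C" "x \<noteq> v" using other CD by blast
  have "\<forall>y\<in>verts E. y \<noteq> v \<longrightarrow> (adj (delete_vertex G v))\<^sup>*\<^sup>* x y" if "?P\<^sup>*\<^sup>* C E" for E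
    using that
  proof (induction rule: rtranclp_induct)
    case base
    then show ?case using CD x cycle_reach_delete_vertex[of C] by blast
  next
    case (step E F)
    obtain w where w: "w \<in> verts E" "w \<in> verts F" using step.hyps by (auto simp: meets_def)
    have EF: "E \<in> cycles G" "F \<in> cycles G" "E \<noteq> F" "{E, F} \<noteq> {C, D}"
      using step.hyps by (auto simp: meets_def)
    \<comment> \<open>Only \<open>C\<close> and \<open>D\<close> contain \<open>v\<close>, and the
      link between these two is excluded, so the detour never crosses at \<open>v\<close>.\<close>
    have "w \<noteq> v"
    proof
      assume "w = v"
      with w EF have "E = C \<or> E = D" "F = C \<or> F = D"
        using cycles_through_cut_vertex[OF assms(1) v(1) CD] by auto
      with EF show False by blast
    qed
    with step.IH w have "(adj (delete_vertex G v))\<^sup>*\<^sup>* x w" by blast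
    with cycle_reach_delete_vertex[OF EF(2) w(2) _ \<open>w \<noteq> v\<close>] show ?case
      by (meson rtranclp_trans)
  qed
  then have "\<forall>y\<in>verts D. y \<noteq> v \<longrightarrow> (adj (delete_vertex G v))\<^sup>*\<^sup>* x y" using path by blast
  moreover obtain y where "y \<in> verts D" "y \<noteq> v" using other CD by blast
  ultimately show False using cut_vertex_separates_cycles[OF assms(1) v(1) CD] x by blast
qed

text \<open>By maximality a neighbour of the head lies on the path. At position 2 or later, the path
  itself would be a detour around the link to it, contradicting that links are bridges.\<close>

lemma maximal_path_head_neighbour:
  assumes "distinct xs" "successively R xs" "xs \<noteq> []"
    and symR: "\<And>a b. R a b \<Longrightarrow> R b a" and irreflR: "\<And>a. \<not> R a a"
    and bridge: "\<And>a b. R a b \<Longrightarrow> \<not> (\<lambda>x y. R x y \<and> {x, y} \<noteq> {a, b})\<^sup>*\<^sup>* a b"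
    and maximal: "\<And>e. R e (hd xs) \<Longrightarrow> e \<in> set xs"
    and "R (hd xs) e"
  shows "length xs > 1 \<and> e = xs ! 1"
proof -
  have hd: "hd xs = xs ! 0" using assms(3) by (simp add: hd_conv_nth)
  have "e \<in> set xs" using assms by blast
  then obtain j where j: "j < length xs" "e = xs ! j" by (auto simp: in_set_conv_nth)
  have "j \<noteq> 0" using j assms(8) irreflR hd by metis
  have "\<not> j \<ge> 2"
  proof
    assume "j \<ge> 2"
    let ?P = "\<lambda>x y. R x y \<and> {x, y} \<noteq> {xs ! 0, xs ! j}"
    have "?P\<^sup>*\<^sup>* (xs ! 0) (xs ! i)" if "i \<le> j" for i
      using that
    proof (induction i)
      case (Suc i)
      have "R (xs ! i) (xs ! Suc i)"
        using assms(2) Suc.prems j by (simp add: successively_conv_nth)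
      moreover have "i < length xs" "Suc i < length xs" "0 < length xs"
        using Suc.prems j by auto
      \<comment> \<open>Links of the path join consecutive positions, while 0 and \<open>j\<close>
        are at least 2 apart.\<close>
      then have "{xs ! i, xs ! Suc i} \<noteq> {xs ! 0, xs ! j}"
        using assms(1) Suc.prems j(1) \<open>j \<ge> 2\<close>
        by (simp add: doubleton_eq_iff nth_eq_iff_index_eq) linarith
      ultimately show ?case using Suc by (simp add: rtranclp.rtrancl_into_rtrancl)
    qed simp
    then have "?P\<^sup>*\<^sup>* (xs ! 0) (xs ! j)" by simp
    with bridge assms(8) hd j show False by simp
  qed
  with \<open>j \<noteq> 0\<close> have "j = 1" by simp
  with j show ?thesis by simp
qed

text \<open>A longest path in the relation is closed under neighbours: at an end because the path is
  longest, in the interior because of the degree bound.\<close>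
lemma cycles_in_chain:
  assumes "chain_cactus G" "finite (cycles G)" "cycles G \<noteq> {}"
  obtains xs where "distinct xs" "set xs = cycles G" "successively (meets G) xs"
    "\<And>i. i < length xs \<Longrightarrow> card {D. meets G (xs ! i) D} = 2 \<Longrightarrow> 0 < i \<and> Suc i < length xs"
proof -
  let ?R = "meets G"
  let ?Q = "\<lambda>xs. xs \<noteq> [] \<and> distinct xs \<and> set xs \<subseteq> cycles G \<and> successively ?R xs"
  obtain C0 where "C0 \<in> cycles G" using assms(3) by blast
  then have "?Q [C0]" by simp
  moreover have "\<forall>xs. ?Q xs \<longrightarrow> length xs \<le> card (cycles G)"
    using assms(2) by (metis card_mono distinct_card)
  ultimately obtain xs where xs: "?Q xs" and longest: "\<And>ys. ?Q ys \<Longrightarrow> length ys \<le> length xs"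
    using ex_has_greatest_nat[of ?Q "[C0]" length "Suc (card (cycles G))"] by (auto simp: less_Suc_eq_le)
  have symR: "?R a b \<Longrightarrow> ?R b a" for a b by (simp add: meets_sym)
  have irreflR: "\<not> ?R a a" for a by (simp add: meets_def)
  have head: "length ys > 1 \<and> e = ys ! 1"
    if ys: "?Q ys" "length ys = length xs" "?R (hd ys) e" for ys e
  proof (rule maximal_path_head_neighbour[of ys ?R])
    show "f \<in> set ys" if "?R f (hd ys)" for f
    proof (rule ccontr)
      assume "f \<notin> set ys"
      with ys that have "?Q (f # ys)" by (auto simp: successively_Cons meets_def)
      from longest[OF this] ys show False by simp
    qed
  qed (use ys symR irreflR meets_bridge[OF assms(1)] in auto)
  \<comment> \<open>The reversed path is equally long, so the statement about the head also applies
    to the last cycle.\<close>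
  have "?Q (rev xs)"
    using xs by (auto simp: successively_rev meets_sym[of G] cong: successively_cong)
  have first: "length xs > 1 \<and> e = xs ! 1" if "?R (xs ! 0) e" for e
    using head[OF xs] that xs by (simp add: hd_conv_nth)
  have final: "length xs > 1 \<and> e = xs ! (length xs - 2)" if "?R (xs ! (length xs - 1)) e" for e
  proof -
    have "?R (hd (rev xs)) e" using that xs by (simp add: hd_rev last_conv_nth)
    with head[OF \<open>?Q (rev xs)\<close>] have "length xs > 1" "e = rev xs ! 1" by auto
    then show ?thesis by (simp add: rev_nth numeral_2_eq_2)
  qed
  have fin: "finite {D. ?R C D}" for C
    by (rule finite_subset[OF _ assms(2)]) (auto simp: meets_def)
  have closed: "D \<in> set xs" if "C \<in> set xs" and CD: "?R C D" for C D
  proof -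
    obtain i where i: "i < length xs" "C = xs ! i" using \<open>C \<in> set xs\<close> by (auto simp: in_set_conv_nth)
    show ?thesis
    proof (cases "i = 0 \<or> Suc i = length xs")
      case True
      then show ?thesis using first[of D] final[of D] i CD by (auto dest!: sym[of "Suc i"])
    next
      case False
      then have b: "0 < i" "Suc i < length xs" using i by auto
      have step: "?R (xs ! k) (xs ! Suc k)" if "Suc k < length xs" for k
        using xs that by (simp add: successively_conv_nth)
      have "?R C (xs ! Suc i)" "?R C (xs ! (i - 1))"
        using step[of i] step[of "i - 1"] b i symR by auto
      then have sub: "{xs ! Suc i, xs ! (i - 1)} \<subseteq> {D. ?R C D}" by simp
      have ne: "xs ! Suc i \<noteq> xs ! (i - 1)"
        using xs b by (subst nth_eq_iff_index_eq) auto
      have "C \<in> cycles G" using CD by (simp add: meets_def)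
      \<comment> \<open>The predecessor and the successor on the path already use up this degree, so
        \<open>D\<close> is one of them.\<close>
      then have "card {D. ?R C D} \<le> 2"
        using card_meets_eq_cut_vertices card_cut_vertices_in_cycle assms(1) by metis
      with ne have "{xs ! Suc i, xs ! (i - 1)} = {D. ?R C D}"
        by (intro card_seteq[OF fin sub]) simp
      then have "D \<in> {xs ! Suc i, xs ! (i - 1)}" using CD by blast
      then show ?thesis using b by auto
    qed
  qed
  have "set xs = cycles G"
    by (rule meets_closed_eq_cycles[OF assms(1)]) (use xs closed in auto)
  \<comment> \<open>Either end of the path has at most one neighbour.\<close>
  moreover have "0 < i \<and> Suc i < length xs" if i: "i < length xs" "card {D. ?R (xs ! i) D} = 2" for i
  proof (rule ccontr)
    assume "\<not> ?thesis"
    then have "i = 0 \<or> i = length xs - 1" using i by auto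
    then have "\<exists>c. {D. ?R (xs ! i) D} \<subseteq> {c}" using first final by blast
    then obtain c where "{D. ?R (xs ! i) D} \<subseteq> {c}" by blast
    from card_mono[OF _ this] i show False by simp
  qed
  ultimately show thesis using that xs by blast
qed

text \<open>Two cut vertices mean two neighbouring cycles, so \<open>D\<close> is not an end of the
  path through all cycles; that path is the required chain order.\<close>

lemma two_cut_vertices_internal:
  assumes "chain_cactus G" "finite (cycles G)" "D \<in> cycles G" "card (cut_vertices_in G D) = 2"
  shows "internal_cycle G D"
proof -
  obtain xs where xs: "distinct xs" "set xs = cycles G" "successively (meets G) xs"
    and inner: "\<And>i. i < length xs \<Longrightarrow> card {D. meets G (xs ! i) D} = 2 \<Longrightarrow> 0 < i \<and> Suc i < length xs"
    using cycles_in_chain[OF assms(1,2)] assms(3) by blast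
  have len: "chain_length G = length xs"
    using xs by (metis chain_length_def distinct_card)
  \<comment> \<open>Chain orders count from 1, list positions from 0.\<close>
  define C where "C = (\<lambda>i. xs ! (i - 1))"
  have "bij_betw (\<lambda>i. i - 1) {1..length xs} {..<length xs}"
    by (rule bij_betw_byWitness[where f' = Suc]) auto
  then have "bij_betw (nth xs \<circ> (\<lambda>i. i - 1)) {1..length xs} (cycles G)"
    by (rule bij_betw_trans) (rule bij_betw_nth[OF xs(1) refl xs(2)[symmetric]])
  moreover have "\<exists>v. cut_vertex G v \<and> verts (C i) \<inter> verts (C (Suc i)) = {v}"
    if "i \<in> {1..<length xs}" for i
  proof -
    have "meets G (C i) (C (Suc i))"
      using xs(3) that by (cases i) (auto simp: C_def successively_conv_nth)
    then show ?thesis by (meson meets_common_cut_vertex[OF assms(1)])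
  qed
  ultimately have order: "chain_order G C"
    by (simp add: chain_order_def len comp_def C_def)
  obtain i where i: "i < length xs" "D = xs ! i" using assms(3) xs(2) by (metis in_set_conv_nth)
  have "card {E. meets G D E} = 2" using card_meets_eq_cut_vertices assms by metis
  with inner i have "0 < i" "Suc i < length xs" by auto
  with i len have "2 \<le> Suc i" "Suc i + 1 \<le> chain_length G" "D = C (Suc i)"
    by (simp_all add: C_def)
  with order show ?thesis unfolding internal_cycle_def by blast
qed

section \<open>The independence number\<close>

lemma independence_number_eqI:
  assumes "finite (verts G)" "independent_set G S" "card S = k"
    "\<And>T. independent_set G T \<Longrightarrow> card T \<le> k"
  shows "independence_number G = k"
proof -
  have "finite {S. independent_set G S}"
    by (rule finite_subset[of _ "Pow (verts G)"]) (use assms(1) in \<open>auto simp: independent_set_def\<close>)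
  then show ?thesis
    unfolding independence_number_def
  proof (intro Max_eqI)
    show "k \<in> card ` {S. independent_set G S}" using assms(2,3) by blast
  qed (use assms(4) in auto)
qed

text \<open>A vertex off some fixed cycle has a walk to it; the first edge of this walk lies in a
  cycle.\<close>

lemma vertex_in_cycle:
  assumes "chain_cactus G" "cycles G \<noteq> {}" "v \<in> verts G"
  obtains C where "C \<in> cycles G" "v \<in> verts C"
proof -
  obtain C where C: "C \<in> cycles G" using assms(2) by blast
  show thesis
  proof (cases "v \<in> verts C")
    case True
    with C that show thesis by blast
  next
    case False
    obtain w where w: "w \<in> verts C" using card_verts_cycle[OF cycles_is_cycle[OF C]] by fastforce
    have "(adj G)\<^sup>*\<^sup>* v w"
      using chain_cactus_connected[OF assms(1)] assms(3) w C cycles_verts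
      unfolding connected_graph_def by blast
    then obtain z where "adj G v z" using w False by (metis converse_rtranclpE)
    then obtain E where "E \<in> cycles G" "adj E v z" by (rule edge_in_cycle[OF assms(1)])
    with that show thesis using cycles_adj by metis
  qed
qed

text \<open>The cut vertices of \<open>C\<close> are covered by two vertices with a common
  neighbour: by the meta-position if there are two, and by taking both vertices equal if there is at
  most one.\<close>

lemma large_independent_avoiding_cut_vertices:
  assumes "chain_cactus G" "finite (cycles G)" "\<And>D. internal_cycle G D \<Longrightarrow> in_position G 2 D"
    "C \<in> cycles G"
  obtains S where "S \<subseteq> verts C - cut_vertices_in G C" "card S = card (verts C) div 2"
    "\<And>x y. x \<in> S \<Longrightarrow> y \<in> S \<Longrightarrow> \<not> adj C x y"
proof -
  let ?X = "cut_vertices_in G C"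
  note cyc = cycles_is_cycle[OF assms(4)] and simple = cycles_simple[OF assms(4)]
  have "\<exists>u v w. u \<in> verts C \<and> v \<in> verts C \<and> ?X \<subseteq> {u, v} \<and> adj C u w \<and> adj C w v"
  proof (cases "card ?X = 2")
    case True
    then have "in_position G 2 C" using assms two_cut_vertices_internal by blast
    then obtain u v where uv: "?X = {u, v}" "graph_dist C u v = 2" by (auto simp: in_position_def)
    then have in_C: "u \<in> verts C" "v \<in> verts C" by (auto simp: cut_vertices_in_def)
    then have "(adj C)\<^sup>*\<^sup>* u v"
      using nonseparable_cycle[OF cyc] by (auto simp: nonseparable_def connected_graph_def)
    then obtain k where "(adj C ^^ k) u v" by (metis rtranclp_imp_relpowp)
    \<comment> \<open>The \<open>LEAST\<close> in \<open>graph_dist\<close> is attained because some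
      walk from \<open>u\<close> to \<open>v\<close> exists.\<close>
    then have "(adj C ^^ 2) u v" using uv(2) LeastI unfolding graph_dist_def by metis
    then obtain w where "adj C u w" "adj C w v" by (auto simp: numeral_2_eq_2 OO_def)
    with uv in_C show ?thesis by blast
  next
    case False
    then have "card ?X \<le> 1" using card_cut_vertices_in_cycle[OF assms(1,4)] by simp
    moreover have "finite ?X"
      using simple by (auto simp: cut_vertices_in_def simple_graph_def)
    ultimately have single: "x = y" if "x \<in> ?X" "y \<in> ?X" for x y
      using that by (simp add: card_le_Suc0_iff_eq)
    obtain u0 where u0: "u0 \<in> verts C" using card_verts_cycle[OF cyc] by fastforce
    have "\<exists>u. u \<in> verts C \<and> ?X \<subseteq> {u}"
    proof (cases "?X = {}")
      case True
      with u0 show ?thesis by blast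
    next
      case False
      then obtain u where "u \<in> ?X" by blast
      with single have "u \<in> verts C \<and> ?X \<subseteq> {u}" by (auto simp: cut_vertices_in_def)
      then show ?thesis by blast
    qed
    then obtain u where u: "u \<in> verts C" "?X \<subseteq> {u}" by blast
    then obtain w where "adj C u w" using cycle_neighbour[OF cyc] by blast
    \<comment> \<open>Here \<open>v\<close> is \<open>u\<close> itself: the walk goes to
      \<open>w\<close> and back.\<close>
    with u show ?thesis using adj_sym[of C] by blast
  qed
  then obtain u v w where uvw: "u \<in> verts C" "v \<in> verts C" "?X \<subseteq> {u, v}" "adj C u w" "adj C w v"
    by blast
  have w: "w \<in> verts C" using simple_graph_adj[OF simple uvw(4)] by simp
  show thesis
  proof (rule large_independent_avoiding[OF cyc uvw(1,2,4,5) w])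
    fix S assume "S \<subseteq> verts C - {u, v}" "card S = card (verts C) div 2"
      "\<And>x y. x \<in> S \<Longrightarrow> y \<in> S \<Longrightarrow> \<not> adj C x y"
    moreover from this have "S \<subseteq> verts C - ?X" using uvw(3) by blast
    ultimately show thesis using that by blast
  qed
qed

theorem theorem7:
  fixes h n :: nat and M :: "'a graph"
  assumes "h \<ge> 3" and "n \<ge> 1" and "meta_chain h n M"
  shows "independence_number M = n * (h div 2)"
proof -
  have cc: "chain_cactus M" and h: "\<And>C. C \<in> cycles M \<Longrightarrow> card (verts C) = h"
    and n: "card (cycles M) = n" and pos: "\<And>D. internal_cycle M D \<Longrightarrow> in_position M 2 D"
    using assms(3) by (auto simp: meta_chain_def chain_h_cactus_def chain_length_def)
  have fin: "finite (cycles M)" and ne: "cycles M \<noteq> {}"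
    using n assms(2) by (auto intro: card_ge_0_finite)
  note simple = chain_cactus_simple[OF cc]
  have "\<forall>C\<in>cycles M. \<exists>S. S \<subseteq> verts C - cut_vertices_in M C \<and> card S = h div 2 \<and>
      (\<forall>x\<in>S. \<forall>y\<in>S. \<not> adj C x y)"
    using large_independent_avoiding_cut_vertices[OF cc fin pos] h by metis
  then obtain S where S: "\<And>C. C \<in> cycles M \<Longrightarrow> S C \<subseteq> verts C - cut_vertices_in M C"
    "\<And>C. C \<in> cycles M \<Longrightarrow> card (S C) = h div 2"
    "\<And>C x y. C \<in> cycles M \<Longrightarrow> x \<in> S C \<Longrightarrow> y \<in> S C \<Longrightarrow> \<not> adj C x y"
    by metis
  \<comment> \<open>A vertex of \<open>S C\<close> is not a cut vertex, so no second cycle contains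
    it.\<close>
  have only: "D = C" if "C \<in> cycles M" "D \<in> cycles M" "x \<in> S C" "x \<in> verts D" for C D x
    using common_vertex_is_cut[OF cc that(1,2), of x] S(1)[OF that(1)] that
    by (auto simp: cut_vertices_in_def)
  let ?T = "\<Union>C\<in>cycles M. S C"
  have finS: "finite (S C)" if "C \<in> cycles M" for C
    using S(1)[OF that] cycles_simple[OF that] by (auto simp: simple_graph_def intro: finite_subset)
  show ?thesis
  proof (rule independence_number_eqI)
    show "finite (verts M)" using simple by (simp add: simple_graph_def)
    show "independent_set M ?T"
      unfolding independent_set_def
    proof (intro conjI ballI notI)
      show "?T \<subseteq> verts M" using S(1) cycles_verts by fast
      fix x y assume x: "x \<in> ?T" and y: "y \<in> ?T" and "adj M x y"
      \<comment> \<open>The edge lies in one cycle \<open>E\<close>, so both its ends were chosen in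
        \<open>S E\<close>, which is independent in \<open>E\<close>.\<close>
      obtain E where E: "E \<in> cycles M" "adj E x y" by (rule edge_in_cycle[OF cc \<open>adj M x y\<close>])
      have "x \<in> verts E" "y \<in> verts E" using cycles_adj[OF E] by auto
      with x y only E have "x \<in> S E" "y \<in> S E" by blast+
      with S(3) E show False by blast
    qed
    have "S C \<inter> S D = {}" if "C \<in> cycles M" "D \<in> cycles M" "C \<noteq> D" for C D
      using only[OF that(1,2)] S(1)[OF that(2)] that(3) by blast
    then have "card ?T = (\<Sum>C\<in>cycles M. card (S C))"
      using fin finS by (intro card_UN_disjoint) auto
    then show "card ?T = n * (h div 2)" using S(2) n by simp
  next
    \<comment> \<open>Upper bound: the cycles cover all vertices, and each contributes at most
      \<open>h div 2\<close> to \<open>T\<close>; cut vertices may be counted twice.\<close>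
    fix T assume T: "independent_set M T"
    have "card (T \<inter> verts C) \<le> h div 2" if C: "C \<in> cycles M" for C
    proof -
      have "card (T \<inter> verts C) \<le> card (verts C) div 2"
      proof (rule card_independent_in_cycle[OF cycles_is_cycle[OF C]])
        fix x y assume "x \<in> T \<inter> verts C" "y \<in> T \<inter> verts C"
        then show "\<not> adj C x y"
          using T cycles_edges[OF C] by (auto simp: independent_set_def adj_def)
      qed auto
      with h[OF C] show ?thesis by simp
    qed
    then have bound: "(\<Sum>C\<in>cycles M. card (T \<inter> verts C)) \<le> n * (h div 2)"
      using sum_bounded_above[of "cycles M" "\<lambda>C. card (T \<inter> verts C)" "h div 2"] n by simp
    have "finite T"
      using T simple finite_subset by (auto simp: independent_set_def simple_graph_def)
    have "T \<subseteq> (\<Union>C\<in>cycles M. T \<inter> verts C)"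
    proof
      fix x assume "x \<in> T"
      then have "x \<in> verts M" using T by (auto simp: independent_set_def)
      then obtain C where "C \<in> cycles M" "x \<in> verts C" by (rule vertex_in_cycle[OF cc ne])
      with \<open>x \<in> T\<close> show "x \<in> (\<Union>C\<in>cycles M. T \<inter> verts C)" by blast
    qed
    then have "card T \<le> card (\<Union>C\<in>cycles M. T \<inter> verts C)"
      using fin \<open>finite T\<close> by (intro card_mono) auto
    also have "\<dots> \<le> (\<Sum>C\<in>cycles M. card (T \<inter> verts C))" by (rule card_UN_le[OF fin])
    finally show "card T \<le> n * (h div 2)" using bound by simp
  qed
qed

end
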